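(* Let $a_h$ and $a_h^+$ ($0<h\le h_0$) be bilinear forms on $\mathcal{V}\times\mathcal{V}$ that are continuous and coercive uniformly in $h$, with continuity constant $M$ and coercivity constant $\alpha$. Then for every $u\in\mathcal{V}$ and every $h\le h_0$, $$ \begin{split} \| r_h^+ u - r_h u \|_{s,2} \le \inf_{\substack{e_h \in \mathcal{V}_h \\ e_h^+ \in \mathcal{V}_h^+}} \Big[ \frac{M}{\alpha} &\left\| r_h^+ u - r_h u - (e_h + e_h^+) \right\|_{s,2} \\ + &\frac{1}{\sqrt{\alpha}} \big( \left|a_h^+(r_h^+u - u, e_h)\right|^{1/2} + \left|a_h(r_h u - u, e_h^+)\right|^{1/2} \\ &+ \left|a_h^+(r_h u - u, e_h + e_h^+) - a_h(r_h u - u, e_h + e_h^+)\right|^{1/2} \big) \Big]. \end{split} $$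
   Context: Let $s\ge 0$ be an integer, $\Omega\subset\mathbb{R}^d$ ($d \ge 1$) an open, bounded, Lipschitz domain, and $\mathcal{V}$ a closed subspace of $H^s(\Omega)=W^{s,2}(\Omega)$ (with $H^0=L^2$). $\|\cdot\|_{s,p}$ denotes the norm of the Sobolev space $W^{s,p}(\Omega)$. Let $h_0>0$. For each $0<h\le h_0$, $a_h,a_h^+:\mathcal{V}\times\mathcal{V}\to\mathbb{R}$ are (not necessarily symmetric) bilinear forms. "Uniformly continuous and coercive" means there are constants $\alpha>0$ and $M>0$ independent of $h$ such that $a_h(u,u)\ge\alpha\|u\|_{s,2}^2$ and $a_h(u,w)\le M\|u\|_{s,2}\|w\|_{s,2}$ for all $u,w\in\mathcal{V}$ and all $h\le h_0$, and the same inequalities hold for $a_h^+$ with the same constants. Let $\{\mathcal{V}_h\}_{0<h\le h_0}$ and $\{\mathcal{V}_h^+\}_{0<h\le h_0}$ be two families of finite element (finite-dimensional) subspaces of $\mathcal{V}$. The linear projectors $r_h:\mathcal{V}\to\mathcal{V}_h$ and $r_h^+:\mathcal{V}\to\mathcal{V}_h^+$ are defined (uniquely, by Lax-Milgram) by $a_h(r_hu-u,w_h)=0$ for all $w_h\in\mathcal{V}_h$, and $a_h^+(r_h^+u-u,w_h^+)=0$ for all $w_h^+\in\mathcal{V}_h^+$. *)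

theory Defs
  imports "HOL-Analysis.Analysis"
begin

section \<open>Measurable functions modulo null sets\<close>

text \<open>
  Elements of Sobolev spaces are classes of functions modulo equality almost everywhere.
  A class of functions on \<open>\<Omega>\<close> is represented by its extension by zero, i.e. by a class of
  Lebesgue measurable functions on the whole space that vanishes almost everywhere outside \<open>\<Omega>\<close>;
  then integrals over the whole space are integrals over \<open>\<Omega>\<close>.
\<close>

definition ae_rel :: "(real^'d \<Rightarrow> real) \<Rightarrow> (real^'d \<Rightarrow> real) \<Rightarrow> bool" where
  "ae_rel f g \<longleftrightarrow> f \<in> borel_measurable lebesgue \<and> g \<in> borel_measurable lebesgue \<and>
     (AE x in lebesgue. f x = g x)"

quotient_type 'd aefun = "real^'d \<Rightarrow> real" / partial: ae_rel
proof (rule part_equivpI)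
  show "\<exists>f :: real^'d \<Rightarrow> real. ae_rel f f"
    by (rule exI[of _ "\<lambda>_. 0"]) (simp add: ae_rel_def)
  show "symp (ae_rel :: (real^'d \<Rightarrow> real) \<Rightarrow> _)"
    by (auto simp: symp_def ae_rel_def eq_commute)
  show "transp (ae_rel :: (real^'d \<Rightarrow> real) \<Rightarrow> _)"
    unfolding transp_def ae_rel_def by (auto elim: AE_mp)
qed

instantiation aefun :: (finite) real_vector
begin

lift_definition zero_aefun :: "'a aefun" is "\<lambda>_. 0"
  by (simp add: ae_rel_def)

lift_definition plus_aefun :: "'a aefun \<Rightarrow> 'a aefun \<Rightarrow> 'a aefun" is "\<lambda>f g x. f x + g x"
  unfolding ae_rel_def by (auto intro!: borel_measurable_add)

lift_definition minus_aefun :: "'a aefun \<Rightarrow> 'a aefun \<Rightarrow> 'a aefun" is "\<lambda>f g x. f x - g x"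
  unfolding ae_rel_def by (auto intro!: borel_measurable_diff)

lift_definition uminus_aefun :: "'a aefun \<Rightarrow> 'a aefun" is "\<lambda>f x. - f x"
  unfolding ae_rel_def by (auto intro!: borel_measurable_uminus)

lift_definition scaleR_aefun :: "real \<Rightarrow> 'a aefun \<Rightarrow> 'a aefun" is "\<lambda>c f x. c * f x"
  unfolding ae_rel_def by (auto intro!: borel_measurable_times)

instance
  by standard
    (transfer, auto simp: ae_rel_def algebra_simps intro!: borel_measurable_times
      borel_measurable_add borel_measurable_diff borel_measurable_uminus)+

end

lift_definition vanishes_outside :: "(real^'d) set \<Rightarrow> 'd aefun \<Rightarrow> bool"
  is "\<lambda>\<Omega> f. AE x in lebesgue. x \<notin> \<Omega> \<longrightarrow> f x = 0"
  unfolding ae_rel_def by (auto elim!: AE_mp)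

lift_definition Lp_integrable :: "real \<Rightarrow> 'd::finite aefun \<Rightarrow> bool"
  is "\<lambda>p f. integrable lebesgue (\<lambda>x. \<bar>f x\<bar> powr p)"
  unfolding ae_rel_def
  by (intro integrable_cong_AE) (auto elim!: AE_mp)

lift_definition Lp_norm :: "real \<Rightarrow> 'd::finite aefun \<Rightarrow> real"
  is "\<lambda>p f. (LINT x|lebesgue. \<bar>f x\<bar> powr p) powr (1 / p)"
  unfolding ae_rel_def
  by (intro arg_cong[where f = "\<lambda>t. t powr _"] integral_cong_AE) (auto elim!: AE_mp)

text \<open>The integral of \<open>f \<phi>\<close>. It is only used for \<open>f\<close> in a Lebesgue space and continuous \<open>\<phi>\<close> with
  compact support, where the product is integrable.\<close>

lift_definition pairing :: "'d::finite aefun \<Rightarrow> (real^'d \<Rightarrow> real) \<Rightarrow> real"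
  is "\<lambda>f \<phi>. LINT x|lebesgue. f x * \<phi> x"
proof (intro ext)
  fix f g \<phi> :: "real^'d \<Rightarrow> real"
  assume fg: "ae_rel f g"
  then have eq: "AE x in lebesgue. f x * \<phi> x = g x * \<phi> x"
    unfolding ae_rel_def by (auto elim!: AE_mp)
  show "(LINT x|lebesgue. f x * \<phi> x) = (LINT x|lebesgue. g x * \<phi> x)"
  proof (cases "(\<lambda>x. f x * \<phi> x) \<in> borel_measurable lebesgue")
    case True
    then show ?thesis
      using eq borel_measurable_AE[OF True eq] by (intro integral_cong_AE) auto
  next
    case False
    have "(\<lambda>x. g x * \<phi> x) \<notin> borel_measurable lebesgue"
    proof
      assume g: "(\<lambda>x. g x * \<phi> x) \<in> borel_measurable lebesgue"
      have "AE x in lebesgue. g x * \<phi> x = f x * \<phi> x"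
        using eq by eventually_elim (rule sym)
      from borel_measurable_AE[OF g this] False show False
        by (rule notE[rotated])
    qed
    then have "\<not> integrable lebesgue (\<lambda>x. g x * \<phi> x)"
      by (rule contrapos_nn) (rule borel_measurable_integrable)
    moreover have "\<not> integrable lebesgue (\<lambda>x. f x * \<phi> x)"
      using False by (rule contrapos_nn) (rule borel_measurable_integrable)
    ultimately show ?thesis
      by (metis not_integrable_integral_eq)
  qed
qed

definition Lp :: "(real^'d) set \<Rightarrow> real \<Rightarrow> 'd aefun set" where
  "Lp \<Omega> p = {f. vanishes_outside \<Omega> f \<and> Lp_integrable p f}"


section \<open>Test functions and weak derivatives\<close>

definition partial :: "'d \<Rightarrow> (real^'d \<Rightarrow> real) \<Rightarrow> (real^'d \<Rightarrow> real)" where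
  "partial i f = (\<lambda>x. frechet_derivative f (at x) (axis i 1))"

definition iterated_partial :: "'d list \<Rightarrow> (real^'d \<Rightarrow> real) \<Rightarrow> (real^'d \<Rightarrow> real)" where
  "iterated_partial is f = foldr partial is f"

definition smooth :: "(real^'d \<Rightarrow> real) \<Rightarrow> bool" where
  "smooth f \<longleftrightarrow> (\<forall>is. iterated_partial is f differentiable_on UNIV)"

definition test_functions :: "(real^'d) set \<Rightarrow> (real^'d \<Rightarrow> real) set" where
  "test_functions \<Omega> =
     {\<phi>. smooth \<phi> \<and> compact (closure {x. \<phi> x \<noteq> 0}) \<and> closure {x. \<phi> x \<noteq> 0} \<subseteq> \<Omega>}"

text \<open>Multi-indices are functions on the (finite) index type of the coordinates.\<close>

definition multi_order :: "('d::finite \<Rightarrow> nat) \<Rightarrow> nat" where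
  "multi_order \<beta> = (\<Sum>i\<in>UNIV. \<beta> i)"

text \<open>\<open>v\<close> is the weak derivative of \<open>u\<close> of multi-index \<open>\<beta>\<close>. The lists \<open>is\<close> enumerate the directions
  of \<open>\<beta>\<close> with multiplicities, so that \<open>iterated_partial is \<phi>\<close> is the classical derivative of \<open>\<phi>\<close> of
  multi-index \<open>\<beta>\<close>; as \<open>\<phi>\<close> is smooth, it does not depend on the order of the list.\<close>

definition is_weak_derivative ::
    "(real^'d) set \<Rightarrow> ('d \<Rightarrow> nat) \<Rightarrow> 'd aefun \<Rightarrow> 'd aefun \<Rightarrow> bool" where
  "is_weak_derivative \<Omega> \<beta> u v \<longleftrightarrow>
     (\<forall>\<phi>\<in>test_functions \<Omega>. \<forall>is. (\<forall>i. count_list is i = \<beta> i) \<longrightarrow>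
        pairing u (iterated_partial is \<phi>) = (-1) ^ multi_order \<beta> * pairing v \<phi>)"

definition weak_derivative ::
    "(real^'d) set \<Rightarrow> real \<Rightarrow> ('d \<Rightarrow> nat) \<Rightarrow> 'd aefun \<Rightarrow> 'd aefun" where
  "weak_derivative \<Omega> p \<beta> u = (THE v. v \<in> Lp \<Omega> p \<and> is_weak_derivative \<Omega> \<beta> u v)"


section \<open>Sobolev spaces\<close>

text \<open>The space \<open>W\<^sup>s\<^sup>,\<^sup>p(\<Omega>)\<close> and its norm, for \<open>1 \<le> p < \<infinity>\<close>.\<close>

definition sobolev :: "(real^'d) set \<Rightarrow> nat \<Rightarrow> real \<Rightarrow> 'd aefun set" where
  "sobolev \<Omega> s p =
     {u \<in> Lp \<Omega> p. \<forall>\<beta>. multi_order \<beta> \<le> s \<longrightarrow> (\<exists>v\<in>Lp \<Omega> p. is_weak_derivative \<Omega> \<beta> u v)}"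

definition sobolev_norm :: "(real^'d) set \<Rightarrow> nat \<Rightarrow> real \<Rightarrow> 'd aefun \<Rightarrow> real" where
  "sobolev_norm \<Omega> s p u =
     (\<Sum>\<beta> | multi_order \<beta> \<le> s. Lp_norm p (weak_derivative \<Omega> p \<beta> u) powr p) powr (1 / p)"

definition closed_subspace_sobolev ::
    "(real^'d) set \<Rightarrow> nat \<Rightarrow> real \<Rightarrow> 'd aefun set \<Rightarrow> bool" where
  "closed_subspace_sobolev \<Omega> s p V \<longleftrightarrow>
     subspace V \<and> V \<subseteq> sobolev \<Omega> s p \<and>
     (\<forall>f u. range f \<subseteq> V \<longrightarrow> u \<in> sobolev \<Omega> s p \<longrightarrow>
        (\<lambda>n::nat. sobolev_norm \<Omega> s p (f n - u)) \<longlonglongrightarrow> 0 \<longrightarrow> u \<in> V)"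

text \<open>
  Near each boundary point, \<open>\<Omega>\<close> is the part of a ball lying above the graph of a Lipschitz function
  of the \<open>d - 1\<close> coordinates orthogonal to a unit vector \<open>n\<close>. The function is given on the whole space
  and is invariant in direction \<open>n\<close>, which also covers dimension one (constant functions).
  Connectedness is not required.
\<close>

definition lipschitz_domain :: "(real^'d) set \<Rightarrow> bool" where
  "lipschitz_domain \<Omega> \<longleftrightarrow>
     open \<Omega> \<and> bounded \<Omega> \<and> \<Omega> \<noteq> {} \<and>
     (\<forall>x\<in>frontier \<Omega>. \<exists>r>0. \<exists>n L. \<exists>\<gamma> :: real^'d \<Rightarrow> real.
        norm n = 1 \<and> L-lipschitz_on UNIV \<gamma> \<and> (\<forall>y t. \<gamma> (y + t *\<^sub>R n) = \<gamma> y) \<and>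
        \<Omega> \<inter> ball x r = {y \<in> ball x r. \<gamma> y < y \<bullet> n})"


section \<open>Bilinear forms and projectors\<close>

definition bilinear_form_on :: "'a::real_vector set \<Rightarrow> ('a \<Rightarrow> 'a \<Rightarrow> real) \<Rightarrow> bool" where
  "bilinear_form_on V a \<longleftrightarrow>
     (\<forall>u\<in>V. \<forall>v\<in>V. \<forall>w\<in>V. a (u + v) w = a u w + a v w \<and> a w (u + v) = a w u + a w v) \<and>
     (\<forall>c. \<forall>u\<in>V. \<forall>w\<in>V. a (c *\<^sub>R u) w = c * a u w \<and> a u (c *\<^sub>R w) = c * a u w)"

definition continuous_coercive_on ::
    "'a set \<Rightarrow> ('a \<Rightarrow> real) \<Rightarrow> real \<Rightarrow> real \<Rightarrow> ('a \<Rightarrow> 'a \<Rightarrow> real) \<Rightarrow> bool" where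
  "continuous_coercive_on V nrm M \<alpha> a \<longleftrightarrow>
     (\<forall>u\<in>V. a u u \<ge> \<alpha> * (nrm u)\<^sup>2) \<and> (\<forall>u\<in>V. \<forall>w\<in>V. a u w \<le> M * nrm u * nrm w)"

definition finite_dim_subspace_of :: "'a::real_vector set \<Rightarrow> 'a set \<Rightarrow> bool" where
  "finite_dim_subspace_of W V \<longleftrightarrow> W \<subseteq> V \<and> (\<exists>B. finite B \<and> W = span B)"

text \<open>The element of \<open>W\<close> chosen here exists and is unique, by Lax-Milgram, if \<open>a\<close> is continuous and
  coercive on a space containing \<open>W\<close> and \<open>u\<close>.\<close>

definition projector :: "('a::real_vector \<Rightarrow> 'a \<Rightarrow> real) \<Rightarrow> 'a set \<Rightarrow> 'a \<Rightarrow> 'a" where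
  "projector a W u = (SOME v. v \<in> W \<and> (\<forall>w\<in>W. a (v - u) w = 0))"

end

theory Submission
  imports Defs
begin

text \<open>
  Put \<open>\<delta> = r\<^sub>h\<^sup>+ u - r\<^sub>h u\<close>. By coercivity \<open>\<alpha> \<parallel>\<delta>\<parallel>\<^sup>2 \<le> a\<^sub>h\<^sup>+(\<delta>, \<delta> - (e + e\<^sup>+)) + a\<^sub>h\<^sup>+(\<delta>, e + e\<^sup>+)\<close>, where
  the first term is at most \<open>M \<parallel>\<delta>\<parallel> \<parallel>\<delta> - (e + e\<^sup>+)\<parallel>\<close>. In the second one the Galerkin orthogonalities
  \<open>a\<^sub>h\<^sup>+(r\<^sub>h\<^sup>+ u - u, e\<^sup>+) = 0\<close> and \<open>a\<^sub>h(r\<^sub>h u - u, e) = 0\<close> leave exactly the three consistency terms. The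
  estimate then follows from \<open>x\<^sup>2 \<le> p x + q \<Longrightarrow> x \<le> p + \<surd>q\<close>.

  The projectors exist without appeal to definiteness of the norm: by coercivity and continuity
  \<open>a(x, x) = 0\<close> implies \<open>a(y, x) = 0\<close> for all \<open>y\<close>, and this is all that Gram-Schmidt
  orthogonalisation needs.
\<close>

lemma bilinear_form_on_rules:
  assumes "bilinear_form_on V a" "subspace V"
  shows bilinear_form_on_add_left:
      "\<And>x y z. x \<in> V \<Longrightarrow> y \<in> V \<Longrightarrow> z \<in> V \<Longrightarrow> a (x + y) z = a x z + a y z"
    and bilinear_form_on_add_right:
      "\<And>x y z. x \<in> V \<Longrightarrow> y \<in> V \<Longrightarrow> z \<in> V \<Longrightarrow> a x (y + z) = a x y + a x z"
    and bilinear_form_on_scaleR_left: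
      "\<And>c x y. x \<in> V \<Longrightarrow> y \<in> V \<Longrightarrow> a (c *\<^sub>R x) y = c * a x y"
    and bilinear_form_on_scaleR_right:
      "\<And>c x y. x \<in> V \<Longrightarrow> y \<in> V \<Longrightarrow> a x (c *\<^sub>R y) = c * a x y"
    and bilinear_form_on_diff_left:
      "\<And>x y z. x \<in> V \<Longrightarrow> y \<in> V \<Longrightarrow> z \<in> V \<Longrightarrow> a (x - y) z = a x z - a y z"
    and bilinear_form_on_diff_right:
      "\<And>x y z. x \<in> V \<Longrightarrow> y \<in> V \<Longrightarrow> z \<in> V \<Longrightarrow> a x (y - z) = a x y - a x z"
proof -
  show add_left: "a (x + y) z = a x z + a y z" and add_right: "a z (x + y) = a z x + a z y"
    if "x \<in> V" "y \<in> V" "z \<in> V" for x y z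
    using assms(1) that by (simp_all add: bilinear_form_on_def)
  show "a (c *\<^sub>R x) y = c * a x y" and "a x (c *\<^sub>R y) = c * a x y"
    if "x \<in> V" "y \<in> V" for c x y
    using assms(1) that by (simp_all add: bilinear_form_on_def)
  \<comment> \<open>Additivity is applied to \<open>(x - y) + y\<close>, which is
    \<open>x\<close>.\<close>
  show "a (x - y) z = a x z - a y z" and "a z (x - y) = a z x - a z y"
    if "x \<in> V" "y \<in> V" "z \<in> V" for x y z
    using add_left[of "x - y" y z] add_right[of "x - y" y z] that assms(2)
    by (simp_all add: subspace_diff)
qed

text \<open>Induction on \<open>B\<close> with \<open>u\<close> arbitrary, since the step projects
  both \<open>u\<close> and the new vector \<open>b\<close> onto \<open>span B\<close>. As
  \<open>a\<close> may be nonsymmetric, orthogonality always means that \<open>a _ w\<close>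
  vanishes, with the residual on the left.\<close>

lemma exists_projection_onto_span:
  assumes bil: "bilinear_form_on V a" and V: "subspace V"
    and null: "\<And>x y. x \<in> V \<Longrightarrow> y \<in> V \<Longrightarrow> a x x = 0 \<Longrightarrow> a y x = 0"
    and "finite B" "B \<subseteq> V" "u \<in> V"
  shows "\<exists>v\<in>span B. \<forall>w\<in>span B. a (v - u) w = 0"
  using \<open>finite B\<close> \<open>B \<subseteq> V\<close> \<open>u \<in> V\<close>
proof (induction B arbitrary: u rule: finite_induct)
  case empty
  have "a (0 - u) (0 *\<^sub>R u) = 0 * a (0 - u) u"
    using empty.prems V
    by (intro bilinear_form_on_scaleR_right[OF bil V] subspace_diff) (auto simp: subspace_0)
  then show ?case by simp
next
  case (insert b B)
  note rules = bilinear_form_on_rules[OF bil V]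
  have b: "b \<in> V" and B: "span B \<subseteq> V"
    using insert.prems V span_minimal[of B V] by auto
  obtain p where p: "p \<in> span B" and p_orth: "\<And>w. w \<in> span B \<Longrightarrow> a (p - b) w = 0"
    using insert.IH[of b] insert.prems b by auto
  obtain v where v: "v \<in> span B" and v_orth: "\<And>w. w \<in> span B \<Longrightarrow> a (v - u) w = 0"
    using insert.IH[of u] insert.prems by auto
  \<comment> \<open>This is the Gram-Schmidt direction. Adding a multiple of \<open>d\<close> to
    \<open>v\<close> keeps the residual orthogonal to \<open>span B\<close>, so the coefficient only
    has to settle the test vector \<open>d\<close>.\<close>
  define d where "d = b - p"
  have in_V: "p \<in> V" "v \<in> V" "d \<in> V" "v - u \<in> V"
    using p v B b insert.prems V by (auto simp: d_def subspace_diff)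
  have d_orth: "a d w = 0" if "w \<in> span B" for w
  proof -
    have "w \<in> V" using that B by blast
    then show ?thesis
      using p_orth[OF that] in_V(1) b by (simp add: d_def rules)
  qed
  \<comment> \<open>If \<open>a d d = 0\<close>, then \<open>c = 0\<close> by division by zero, and it works by \<open>null\<close>.\<close>
  define c where "c = - a (v - u) d / a d d"
  have c: "a (v - u) d + c * a d d = 0"
    using null[OF in_V(3,4)] by (cases "a d d = 0") (simp_all add: c_def)
  have "v + c *\<^sub>R d \<in> span (insert b B)"
  proof -
    have "span B \<subseteq> span (insert b B)" and "b \<in> span (insert b B)"
      by (auto intro: span_mono[THEN subsetD] span_base)
    then show ?thesis
      unfolding d_def using p v by (blast intro: span_add span_scale span_diff)
  qed
  moreover have "a (v + c *\<^sub>R d - u) w = 0" if w: "w \<in> span (insert b B)" for w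
  proof -
    obtain k where k: "w - k *\<^sub>R b \<in> span B"
      using w by (auto simp: span_insert)
    \<comment> \<open>Substituting \<open>b = d + p\<close> splits \<open>w\<close> into a part in
      \<open>span B\<close> and the multiple \<open>k\<close> of \<open>d\<close>.\<close>
    define z where "z = w - k *\<^sub>R b + k *\<^sub>R p"
    have z: "z \<in> span B" "z \<in> V"
      using k p B by (auto simp: z_def intro!: span_add span_scale)
    have w_eq: "w = z + k *\<^sub>R d"
      by (simp add: z_def d_def algebra_simps)
    have kd: "k *\<^sub>R d \<in> V" and cd: "c *\<^sub>R d \<in> V"
      using in_V V by (auto simp: subspace_scale)
    have wV: "w \<in> V"
      unfolding w_eq using z kd V by (simp add: subspace_add)
    have "a (v + c *\<^sub>R d - u) w = a (v - u + c *\<^sub>R d) w"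
      by (simp add: algebra_simps)
    also have "\<dots> = a (v - u) w + c * a d w"
      using in_V cd wV by (simp only: rules)
    also have "a (v - u) w = k * a (v - u) d"
      unfolding w_eq using in_V kd z v_orth[OF z(1)] by (simp add: rules)
    also have "a d w = k * a d d"
      unfolding w_eq using in_V kd z d_orth[OF z(1)] by (simp add: rules)
    also have "k * a (v - u) d + c * (k * a d d) = k * (a (v - u) d + c * a d d)"
      by (simp add: algebra_simps)
    finally show ?thesis using c by simp
  qed
  ultimately show ?case by blast
qed

text \<open>Since \<open>projector\<close> is a \<open>SOME\<close> choice, both properties follow
  once a candidate exists.\<close>

lemma projector_props:
  assumes bil: "bilinear_form_on V a" and V: "subspace V"
    and cc: "continuous_coercive_on V nrm M \<alpha> a" and "0 < \<alpha>"
    and W: "finite_dim_subspace_of W V" and u: "u \<in> V"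
  shows projector_mem: "projector a W u \<in> W"
    and projector_orthogonal: "\<And>w. w \<in> W \<Longrightarrow> a (projector a W u - u) w = 0"
proof -
  have null: "a y x = 0" if "x \<in> V" "y \<in> V" "a x x = 0" for x y
  proof -
    have "\<alpha> * (nrm x)\<^sup>2 \<le> 0"
      using cc that by (metis continuous_coercive_on_def)
    then have x0: "nrm x = 0"
      using \<open>0 < \<alpha>\<close> by (simp add: mult_le_0_iff)
    have le: "a z x \<le> 0" if "z \<in> V" for z
    proof -
      have "a z x \<le> M * nrm z * nrm x"
        using cc that \<open>x \<in> V\<close> by (simp add: continuous_coercive_on_def)
      then show ?thesis by (simp add: x0)
    qed
    \<comment> \<open>Continuity bounds \<open>a\<close> from above only; the bound at
      \<open>-y\<close> gives the reverse inequality.\<close>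
    have "(-1) *\<^sub>R y \<in> V"
      using V \<open>y \<in> V\<close> by (rule subspace_scale)
    from le[OF this] le[OF \<open>y \<in> V\<close>] show ?thesis
      using bilinear_form_on_scaleR_left[OF bil V, of y x "-1"] that by simp
  qed
  obtain B where B: "finite B" "W = span B" and "W \<subseteq> V"
    using W unfolding finite_dim_subspace_of_def by metis
  then have "B \<subseteq> V" using span_superset[of B] by (metis order_trans)
  have "\<exists>v\<in>span B. \<forall>w\<in>span B. a (v - u) w = 0"
    by (rule exists_projection_onto_span[OF bil V]) (fact null B(1) \<open>B \<subseteq> V\<close> u)+
  then have "\<exists>v. v \<in> W \<and> (\<forall>w\<in>W. a (v - u) w = 0)"
    unfolding B(2) by (simp only: Bex_def)
  then have "projector a W u \<in> W \<and> (\<forall>w\<in>W. a (projector a W u - u) w = 0)"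
    unfolding projector_def by (rule someI_ex)
  then show "projector a W u \<in> W" "\<And>w. w \<in> W \<Longrightarrow> a (projector a W u - u) w = 0"
    by simp_all
qed

text \<open>If \<open>x\<close> exceeded \<open>p + sqrt q\<close>, then both \<open>x - p\<close>
  and \<open>x\<close> would exceed \<open>sqrt q\<close>, so their product would exceed
  \<open>q\<close>.\<close>

lemma le_add_sqrt_if_power2_le:
  fixes x p q :: real
  assumes "x\<^sup>2 \<le> p * x + q" "0 \<le> p" "0 \<le> q"
  shows "x \<le> p + sqrt q"
proof (rule ccontr)
  assume "\<not> x \<le> p + sqrt q"
  then have "sqrt q < x - p" "sqrt q < x" using assms by auto
  moreover have "0 \<le> sqrt q" using assms by simp
  ultimately have "sqrt q * sqrt q < (x - p) * x"
    by (intro mult_strict_mono) linarith+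
  then show False using assms by (simp add: power2_eq_square algebra_simps)
qed

text \<open>This is the bound for one fixed pair \<open>e\<close>, \<open>ep\<close>; the theorem
  passes to the infimum over all pairs.\<close>

lemma projector_difference_le:
  assumes V: "subspace V" and bil: "bilinear_form_on V a" "bilinear_form_on V ap"
    and cc: "continuous_coercive_on V nrm M \<alpha> a" "continuous_coercive_on V nrm M \<alpha> ap"
    and nonneg: "\<And>x. 0 \<le> nrm x" and pos: "0 < \<alpha>" "0 \<le> M"
    and W: "finite_dim_subspace_of W V" "finite_dim_subspace_of Wp V"
    and u: "u \<in> V" and e: "e \<in> W" and ep: "ep \<in> Wp"
    and r_def: "r = projector a W u" and rp_def: "rp = projector ap Wp u"
  shows "nrm (rp - r) \<le> M / \<alpha> * nrm (rp - r - (e + ep))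
    + 1 / sqrt \<alpha> * (sqrt \<bar>ap (rp - u) e\<bar> + sqrt \<bar>a (r - u) ep\<bar>
      + sqrt \<bar>ap (r - u) (e + ep) - a (r - u) (e + ep)\<bar>)"
proof -
  define \<delta> where "\<delta> = rp - r"
  define A B C where "A = \<bar>ap (rp - u) e\<bar>" and "B = \<bar>a (r - u) ep\<bar>"
    and "C = \<bar>ap (r - u) (e + ep) - a (r - u) (e + ep)\<bar>"
  \<comment> \<open>Items 1 to 6 concern \<open>a\<close> and 7 to 12 concern \<open>ap\<close>,
    each in the order sum, scalar multiple, difference, left argument before right.\<close>
  note rules = bilinear_form_on_rules[OF bil(1) V] bilinear_form_on_rules[OF bil(2) V]
  have r: "r \<in> W" "a (r - u) e = 0"
    unfolding r_def using projector_props[OF bil(1) V cc(1) pos(1) W(1) u] e by auto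
  have rp: "rp \<in> Wp" "ap (rp - u) ep = 0"
    unfolding rp_def using projector_props[OF bil(2) V cc(2) pos(1) W(2) u] ep by auto
  have mem: "r \<in> V" "rp \<in> V" "e \<in> V" "ep \<in> V"
    using r rp e ep W by (auto simp: finite_dim_subspace_of_def)
  have mem': "\<delta> \<in> V" "e + ep \<in> V" "\<delta> - (e + ep) \<in> V" "r - u \<in> V" "rp - u \<in> V"
    using mem u V by (auto simp: \<delta>_def subspace_diff subspace_add)
  have "\<alpha> * (nrm \<delta>)\<^sup>2 \<le> ap \<delta> \<delta>"
    using cc(2) mem' by (simp add: continuous_coercive_on_def)
  also have "ap \<delta> \<delta> = ap \<delta> (\<delta> - (e + ep)) + ap \<delta> (e + ep)"
    using mem' by (simp add: rules(12))
  also have "ap \<delta> (\<delta> - (e + ep)) \<le> M * nrm \<delta> * nrm (\<delta> - (e + ep))"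
    using cc(2) mem' by (simp add: continuous_coercive_on_def)
  \<comment> \<open>Inserting \<open>u\<close> exposes the two projection errors.\<close>
  also have "ap \<delta> (e + ep) = ap ((rp - u) - (r - u)) (e + ep)"
    by (simp add: \<delta>_def)
  also have "\<dots> = ap (rp - u) (e + ep) - ap (r - u) (e + ep)"
    using mem' by (intro rules(11))
  also have "ap (rp - u) (e + ep) = ap (rp - u) e"
    using mem mem' rp by (simp add: rules(8))
  \<comment> \<open>Add and subtract \<open>a (r - u) (e + ep)\<close>, which reduces to
    \<open>a (r - u) ep\<close>.\<close>
  also have "ap (rp - u) e - ap (r - u) (e + ep) \<le> A + B + C"
  proof -
    have "a (r - u) (e + ep) = a (r - u) ep"
      using mem mem' r by (simp add: rules(2))
    then show ?thesis unfolding A_def B_def C_def by linarith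
  qed
  finally have "\<alpha> * (nrm \<delta>)\<^sup>2 \<le> M * nrm \<delta> * nrm (\<delta> - (e + ep)) + (A + B + C)"
    by simp
  then have "(nrm \<delta>)\<^sup>2 \<le> (M * nrm \<delta> * nrm (\<delta> - (e + ep)) + (A + B + C)) / \<alpha>"
    using pos by (simp add: pos_le_divide_eq mult.commute)
  then have "(nrm \<delta>)\<^sup>2 \<le> M / \<alpha> * nrm (\<delta> - (e + ep)) * nrm \<delta> + (A + B + C) / \<alpha>"
    by (simp add: add_divide_distrib mult_ac)
  \<comment> \<open>Here \<open>p\<close> is \<open>M / \<alpha> * nrm (\<delta> - (e + ep))\<close>
    and \<open>q\<close> is \<open>(A + B + C) / \<alpha>\<close>.\<close>
  then have "nrm \<delta> \<le> M / \<alpha> * nrm (\<delta> - (e + ep)) + sqrt ((A + B + C) / \<alpha>)"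
    using pos nonneg by (intro le_add_sqrt_if_power2_le) (auto simp: A_def B_def C_def)
  also have "sqrt ((A + B + C) / \<alpha>) \<le> 1 / sqrt \<alpha> * (sqrt A + sqrt B + sqrt C)"
  proof -
    have "sqrt (A + B + C) \<le> sqrt A + sqrt B + sqrt C"
      using sqrt_add_le_add_sqrt[of "A + B" C] sqrt_add_le_add_sqrt[of A B]
      by (simp add: A_def B_def C_def)
    then show ?thesis
      using pos by (simp add: real_sqrt_divide divide_right_mono)
  qed
  finally show ?thesis
    by (simp only: \<delta>_def A_def B_def C_def)
qed

theorem theorem2p1:
  fixes \<Omega> :: "(real^'d) set" and s :: nat and V :: "'d aefun set"
    and h0 M \<alpha> :: real
    and a ap :: "real \<Rightarrow> 'd aefun \<Rightarrow> 'd aefun \<Rightarrow> real"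
    and Vh Vhp :: "real \<Rightarrow> 'd aefun set"
    and u :: "'d aefun" and h :: real
  defines "nrm \<equiv> sobolev_norm \<Omega> s 2"
    and "r \<equiv> (\<lambda>h. projector (a h) (Vh h))"
    and "rp \<equiv> (\<lambda>h. projector (ap h) (Vhp h))"
  assumes "lipschitz_domain \<Omega>"
    and "closed_subspace_sobolev \<Omega> s 2 V"
    and "0 < h0" and "0 < \<alpha>" and "0 < M"
    and "\<And>h. 0 < h \<Longrightarrow> h \<le> h0 \<Longrightarrow> bilinear_form_on V (a h)"
    and "\<And>h. 0 < h \<Longrightarrow> h \<le> h0 \<Longrightarrow> bilinear_form_on V (ap h)"
    and "\<And>h. 0 < h \<Longrightarrow> h \<le> h0 \<Longrightarrow> continuous_coercive_on V nrm M \<alpha> (a h)"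
    and "\<And>h. 0 < h \<Longrightarrow> h \<le> h0 \<Longrightarrow> continuous_coercive_on V nrm M \<alpha> (ap h)"
    and "\<And>h. 0 < h \<Longrightarrow> h \<le> h0 \<Longrightarrow> finite_dim_subspace_of (Vh h) V"
    and "\<And>h. 0 < h \<Longrightarrow> h \<le> h0 \<Longrightarrow> finite_dim_subspace_of (Vhp h) V"
    and "u \<in> V" and "0 < h" and "h \<le> h0"
  shows "nrm (rp h u - r h u) \<le>
    (INF (e, ep) \<in> Vh h \<times> Vhp h.
       M / \<alpha> * nrm (rp h u - r h u - (e + ep))
       + 1 / sqrt \<alpha> *
         (sqrt \<bar>ap h (rp h u - u) e\<bar> + sqrt \<bar>a h (r h u - u) ep\<bar>
          + sqrt \<bar>ap h (r h u - u) (e + ep) - a h (r h u - u) (e + ep)\<bar>))"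
proof -
  \<comment> \<open>Nonnegativity holds for every argument because \<open>sobolev_norm\<close> is a
    value of \<open>powr\<close>.\<close>
  have V: "subspace V" and nonneg: "\<And>x. 0 \<le> nrm x"
    using assms(5) by (auto simp: closed_subspace_sobolev_def nrm_def sobolev_norm_def)
  \<comment> \<open>A lower bound passes to a real infimum only over a nonempty index set; both
    spaces are spans and contain 0.\<close>
  have "Vh h \<times> Vhp h \<noteq> {}"
    using assms(13,14)[OF \<open>0 < h\<close> \<open>h \<le> h0\<close>]
    by (auto simp: finite_dim_subspace_of_def intro: span_zero)
  then show ?thesis
  proof (rule cINF_greatest, clarify)
    fix e ep assume "e \<in> Vh h" "ep \<in> Vhp h"
    then show "nrm (rp h u - r h u) \<le> M / \<alpha> * nrm (rp h u - r h u - (e + ep))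
       + 1 / sqrt \<alpha> *
         (sqrt \<bar>ap h (rp h u - u) e\<bar> + sqrt \<bar>a h (r h u - u) ep\<bar>
          + sqrt \<bar>ap h (r h u - u) (e + ep) - a h (r h u - u) (e + ep)\<bar>)"
      using projector_difference_le[OF V assms(9-12)[OF \<open>0 < h\<close> \<open>h \<le> h0\<close>] nonneg \<open>0 < \<alpha>\<close> _
          assms(13,14)[OF \<open>0 < h\<close> \<open>h \<le> h0\<close>] \<open>u \<in> V\<close>] \<open>0 < M\<close>
      by (simp add: r_def rp_def)
  qed
qed

end
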